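(* Let $I=[a,b]\subset\mathbb{R}$ be a compact interval and let $\{f_k\}_{k=1}^\infty$ be a sequence of Sequential Henstock integrable functions $f_k:I\to\mathbb{R}$ converging to $f:I\to\mathbb{R}$ uniformly on $I$. Then $f$ is Sequential Henstock integrable on $I$ and $$\int_I f=\lim_{k\to\infty}\int_I f_k.$$
   Context: A tagged partition $P=\{([x_{i-1},x_i],t_i)\}_{i=1}^m$ of $I=[a,b]$ consists of points $a=x_0<x_1<\dots<x_m=b$ together with tags $t_i\in[x_{i-1},x_i]$. Its Riemann sum for $f$ is $S(f,P)=\sum_{i=1}^m f(t_i)(x_i-x_{i-1})$. A gauge on $I$ is a function $\delta:I\to\mathbb{R}$ with $\delta(x)>0$ for all $x\in I$. $P$ is $\delta(x)$-fine if $x_i-x_{i-1}<\delta(t_i)$ for every $i$. $f$ is Sequential Henstock integrable on $I$ with integral $A=\int_I f\in\mathbb{R}$ if there is a sequence of gauges $\{\delta_n\}_{n=1}^\infty$ on $I$ such that, whenever $P_n$ is a $\delta_n(x)$-fine tagged partition of $I$ for each $n$, one has $S(f,P_n)\to A$ as $n\to\infty$. The value of the integral is unique. *)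

theory Defs
  imports "HOL-Analysis.Analysis"
begin

(* A value holds the number m of subintervals, the points x_0, ..., x_m and the tags
   t_1, ..., t_m; values of the two functions at other indices are irrelevant. *)
datatype tagged_partition =
  Tagged_Partition (pieces: nat) (point: "nat \<Rightarrow> real") (tag: "nat \<Rightarrow> real")

(* For a < b this forces m > 0.  In the degenerate case a = b the only partition has m = 0
   and its Riemann sum is 0. *)
definition is_tagged_partition :: "real \<Rightarrow> real \<Rightarrow> tagged_partition \<Rightarrow> bool" where
  "is_tagged_partition a b P \<longleftrightarrow>
     point P 0 = a \<and> point P (pieces P) = b \<and>
     (\<forall>i\<in>{1..pieces P}. point P (i - 1) < point P i \<and> tag P i \<in> {point P (i - 1)..point P i})"

definition riemann_sum :: "(real \<Rightarrow> real) \<Rightarrow> tagged_partition \<Rightarrow> real" where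
  "riemann_sum f P = (\<Sum>i=1..pieces P. f (tag P i) * (point P i - point P (i - 1)))"

(* Positive real-valued gauges; the library's "gauge" and "fine" are about neighbourhood-valued
   gauges instead. *)
definition pos_gauge :: "real \<Rightarrow> real \<Rightarrow> (real \<Rightarrow> real) \<Rightarrow> bool" where
  "pos_gauge a b \<delta> \<longleftrightarrow> (\<forall>x\<in>{a..b}. \<delta> x > 0)"

definition gauge_fine :: "(real \<Rightarrow> real) \<Rightarrow> tagged_partition \<Rightarrow> bool" where
  "gauge_fine \<delta> P \<longleftrightarrow> (\<forall>i\<in>{1..pieces P}. point P i - point P (i - 1) < \<delta> (tag P i))"

(* Only the values of f on {a..b} matter.  Sequences are indexed from 0. *)
definition has_seq_henstock_integral :: "(real \<Rightarrow> real) \<Rightarrow> real \<Rightarrow> real \<Rightarrow> real \<Rightarrow> bool" where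
  "has_seq_henstock_integral f A a b \<longleftrightarrow>
     (\<exists>\<delta> :: nat \<Rightarrow> real \<Rightarrow> real.
        (\<forall>n. pos_gauge a b (\<delta> n)) \<and>
        (\<forall>P :: nat \<Rightarrow> tagged_partition.
           (\<forall>n. is_tagged_partition a b (P n) \<and> gauge_fine (\<delta> n) (P n)) \<longrightarrow>
           (\<lambda>n. riemann_sum f (P n)) \<longlonglongrightarrow> A))"

definition seq_henstock_integrable :: "(real \<Rightarrow> real) \<Rightarrow> real \<Rightarrow> real \<Rightarrow> bool" where
  "seq_henstock_integrable f a b \<longleftrightarrow> (\<exists>A. has_seq_henstock_integral f A a b)"

definition seq_henstock_integral :: "(real \<Rightarrow> real) \<Rightarrow> real \<Rightarrow> real \<Rightarrow> real" where
  "seq_henstock_integral f a b = (THE A. has_seq_henstock_integral f A a b)"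

end

theory Submission
  imports Defs
begin

text \<open>
  The integrals of the \<open>f\<^sub>k\<close> converge because the integral is Lipschitz for the uniform norm: if
  \<open>\<bar>f - g\<bar> \<le> e\<close> on \<open>[a, b]\<close>, then the Riemann sums of \<open>f\<close> and \<open>g\<close> over a common partition differ by
  at most \<open>e (b - a)\<close>. Comparing the integrals in this way needs a partition that is fine for two
  gauges at once, and such a partition exists by Cousin's lemma (\<open>fine_partition_exists\<close>). This gives
  \<open>seq_henstock_integral_diff_le\<close>, from which both the uniqueness of the integral and the Cauchy
  property of \<open>\<integral> f\<^sub>k\<close> follow.

  That the limit \<open>A\<close> of these integrals is the integral of \<open>f\<close> is the usual three-term estimate,
  \<open>\<bar>S(f, P) - A\<bar> \<le> \<bar>S(f, P) - S(f\<^sub>k, P)\<bar> + \<bar>S(f\<^sub>k, P) - \<integral> f\<^sub>k\<bar> + \<bar>\<integral> f\<^sub>k - A\<bar>\<close>,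
  with one \<open>k\<close> fixed per error bound. The middle term calls for a single gauge that controls the
  Riemann sums up to a given error; \<open>has_seq_henstock_integral_iff\<close> provides it by showing that
  the sequential definition is equivalent to the classical definition by error bounds.
\<close>

section \<open>Tagged partitions and Cousin's lemma\<close>

lemma tagged_partition_bounds:
  assumes "is_tagged_partition a b P" and "i \<in> {1..pieces P}"
  shows "point P (i - 1) < point P i" and "tag P i \<in> {a..b}"
proof -
  let ?x = "point P"
  have adjacent: "?x (j - 1) < ?x j \<and> tag P j \<in> {?x (j - 1)..?x j}" if "j \<in> {1..pieces P}" for j
    using assms(1) that by (simp add: is_tagged_partition_def)
  have ends: "?x 0 = a" "?x (pieces P) = b"
    using assms(1) by (simp_all add: is_tagged_partition_def)
  have mono: "?x i \<le> ?x j" if "i \<le> j" "j \<le> pieces P" for i j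
    using that
  proof (induction j rule: dec_induct)
    case base
    then show ?case by simp
  next
    case (step n)
    then have "?x i \<le> ?x n" and "Suc n \<in> {1..pieces P}" by auto
    with adjacent[of "Suc n"] show ?case by simp
  qed
  show "?x (i - 1) < ?x i" using adjacent assms(2) by blast
  have "a \<le> ?x (i - 1)" "?x i \<le> b"
    using mono[of 0 "i - 1"] mono[of i "pieces P"] assms(2) ends by auto
  with adjacent[OF assms(2)] show "tag P i \<in> {a..b}" by auto
qed

lemma sum_lengths_tagged_partition:
  assumes "is_tagged_partition a b P"
  shows "(\<Sum>i=1..pieces P. point P i - point P (i - 1)) = b - a"
proof -
  have "(\<Sum>i=1..m. point P i - point P (i - 1)) = point P m - point P 0" for m
    by (induction m) auto
  with assms show ?thesis by (simp add: is_tagged_partition_def)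
qed

lemma riemann_sum_diff_le:
  assumes P: "is_tagged_partition a b P"
    and close: "\<And>x. x \<in> {a..b} \<Longrightarrow> \<bar>f x - g x\<bar> \<le> e"
  shows "\<bar>riemann_sum f P - riemann_sum g P\<bar> \<le> e * (b - a)"
proof -
  let ?len = "\<lambda>i. point P i - point P (i - 1)"
  have "\<bar>riemann_sum f P - riemann_sum g P\<bar> = \<bar>\<Sum>i=1..pieces P. (f (tag P i) - g (tag P i)) * ?len i\<bar>"
    by (simp add: riemann_sum_def left_diff_distrib flip: sum_subtractf)
  also have "\<dots> \<le> (\<Sum>i=1..pieces P. \<bar>(f (tag P i) - g (tag P i)) * ?len i\<bar>)"
    by (rule sum_abs)
  also have "\<dots> \<le> (\<Sum>i=1..pieces P. e * ?len i)"
  proof (rule sum_mono)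
    fix i assume i: "i \<in> {1..pieces P}"
    show "\<bar>(f (tag P i) - g (tag P i)) * ?len i\<bar> \<le> e * ?len i"
      using close[OF tagged_partition_bounds(2)[OF P i]] tagged_partition_bounds(1)[OF P i]
      by (auto simp: abs_mult intro!: mult_right_mono)
  qed
  also have "\<dots> = e * (b - a)"
    using sum_lengths_tagged_partition[OF P] by (simp flip: sum_distrib_left)
  finally show ?thesis .
qed

lemma fine_partition_append:
  assumes P: "is_tagged_partition a b P" "gauge_fine \<delta> P"
    and Q: "is_tagged_partition b c Q" "gauge_fine \<delta> Q"
  shows "\<exists>R. is_tagged_partition a c R \<and> gauge_fine \<delta> R"
proof -
  let ?m = "pieces P"
  define R where "R = Tagged_Partition (?m + pieces Q)
    (\<lambda>i. if i \<le> ?m then point P i else point Q (i - ?m))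
    (\<lambda>i. if i \<le> ?m then tag P i else tag Q (i - ?m))"
  have ends: "point P 0 = a" "point P ?m = b" "point Q 0 = b" "point Q (pieces Q) = c"
    using P(1) Q(1) by (auto simp: is_tagged_partition_def)
  have stepP: "point P (i - 1) < point P i \<and> tag P i \<in> {point P (i - 1)..point P i} \<and>
      point P i - point P (i - 1) < \<delta> (tag P i)" if "i \<in> {1..?m}" for i
    using P that by (simp add: is_tagged_partition_def gauge_fine_def)
  have stepQ: "point Q (i - 1) < point Q i \<and> tag Q i \<in> {point Q (i - 1)..point Q i} \<and>
      point Q i - point Q (i - 1) < \<delta> (tag Q i)" if "i \<in> {1..pieces Q}" for i
    using Q that by (simp add: is_tagged_partition_def gauge_fine_def)
  have "point R (i - 1) < point R i \<and> tag R i \<in> {point R (i - 1)..point R i} \<and>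
      point R i - point R (i - 1) < \<delta> (tag R i)" if i: "i \<in> {1..pieces R}" for i
  proof (cases "i \<le> ?m")
    case True
    then have "i - 1 \<le> ?m" by simp
    with True stepP[of i] i show ?thesis by (simp add: R_def)
  next
    case False
    then obtain j where j: "i = ?m + j" "j \<noteq> 0"
      by (metis add_0_right le_add_diff_inverse nat_le_linear order_refl)
    \<comment> \<open>At \<open>j = 1\<close> the left endpoint comes from \<open>P\<close>, as its last point \<open>b\<close>.\<close>
    have "point R (i - 1) = point Q (j - 1)"
      using j ends by (cases "j = 1") (auto simp: R_def)
    moreover have "point R i = point Q j" "tag R i = tag Q j" "j \<in> {1..pieces Q}"
      using j i by (auto simp: R_def)
    ultimately show ?thesis using stepQ[of j] by simp
  qed
  moreover have "point R 0 = a" "point R (pieces R) = c"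
    using ends by (auto simp: R_def)
  ultimately show ?thesis
    unfolding is_tagged_partition_def gauge_fine_def by blast
qed

text \<open>
  Cousin's lemma. Having a fine partition passes to adjacent unions, and every short enough interval
  around \<open>x\<close> has the one-piece partition tagged by \<open>x\<close>, so the claim follows by bisection.
\<close>

lemma fine_partition_exists:
  assumes "a \<le> b" and "pos_gauge a b \<delta>"
  shows "\<exists>P. is_tagged_partition a b P \<and> gauge_fine \<delta> P"
proof (rule Bolzano[where P = "\<lambda>u v. \<exists>P. is_tagged_partition u v P \<and> gauge_fine \<delta> P"])
  show "a \<le> b" by fact
next
  fix u v w :: real
  assume "\<exists>P. is_tagged_partition u v P \<and> gauge_fine \<delta> P"
    and "\<exists>P. is_tagged_partition v w P \<and> gauge_fine \<delta> P"
  then show "\<exists>P. is_tagged_partition u w P \<and> gauge_fine \<delta> P"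
    using fine_partition_append by blast
next
  fix x assume "a \<le> x" "x \<le> b"
  then have "\<delta> x > 0" using assms(2) by (simp add: pos_gauge_def)
  moreover have "\<exists>P. is_tagged_partition u v P \<and> gauge_fine \<delta> P"
    if "u \<le> x \<and> x \<le> v \<and> v - u < \<delta> x" for u v
  proof (rule exI)
    \<comment> \<open>Pieces must have positive length, so a one-point interval gets no piece at all.\<close>
    let ?P = "Tagged_Partition (if u < v then 1 else 0) (\<lambda>i. if i = 0 then u else v) (\<lambda>_. x)"
    show "is_tagged_partition u v ?P \<and> gauge_fine \<delta> ?P"
      using that by (auto simp: is_tagged_partition_def gauge_fine_def)
  qed
  ultimately show "\<exists>d>0. \<forall>u v. u \<le> x \<and> x \<le> v \<and> v - u < d \<longrightarrow>
      (\<exists>P. is_tagged_partition u v P \<and> gauge_fine \<delta> P)"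
    by blast
qed

section \<open>The sequential Henstock integral\<close>

text \<open>
  For the forward direction, if no gauge of the sequence worked for some \<open>e\<close>, then picking a bad
  partition for each of them would give Riemann sums that stay at distance at least \<open>e\<close> from \<open>A\<close>.
  Conversely, gauges for the errors \<open>1 / (n + 1)\<close> form a suitable sequence.
\<close>

lemma has_seq_henstock_integral_iff:
  "has_seq_henstock_integral f A a b \<longleftrightarrow>
     (\<forall>e>0. \<exists>\<delta>. pos_gauge a b \<delta> \<and>
        (\<forall>P. is_tagged_partition a b P \<and> gauge_fine \<delta> P \<longrightarrow> \<bar>riemann_sum f P - A\<bar> < e))"
    (is "_ \<longleftrightarrow> (\<forall>e>0. \<exists>\<delta>. ?controls e \<delta>)")
proof (intro iffI allI impI)
  fix e :: real
  assume "has_seq_henstock_integral f A a b" "e > 0"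
  then obtain \<delta> where \<delta>: "\<And>n. pos_gauge a b (\<delta> n)"
    and lim: "\<And>P. (\<And>n. is_tagged_partition a b (P n) \<and> gauge_fine (\<delta> n) (P n)) \<Longrightarrow>
                 (\<lambda>n. riemann_sum f (P n)) \<longlonglongrightarrow> A"
    unfolding has_seq_henstock_integral_def by blast
  show "\<exists>\<delta>. ?controls e \<delta>"
  proof (rule ccontr)
    assume "\<nexists>\<delta>. ?controls e \<delta>"
    then have "\<forall>n. \<exists>P. is_tagged_partition a b P \<and> gauge_fine (\<delta> n) P \<and> \<not> \<bar>riemann_sum f P - A\<bar> < e"
      using \<delta> by blast
    then obtain P where P: "\<And>n. is_tagged_partition a b (P n) \<and> gauge_fine (\<delta> n) (P n)"
      and far: "\<And>n. \<not> \<bar>riemann_sum f (P n) - A\<bar> < e"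
      by metis
    from LIMSEQ_D[OF lim[OF P] \<open>e > 0\<close>] far show False by auto
  qed
next
  assume "\<forall>e>0. \<exists>\<delta>. ?controls e \<delta>"
  then have "\<forall>n. \<exists>\<delta>. ?controls (inverse (real (Suc n))) \<delta>" by simp
  then obtain \<delta> where \<delta>: "\<And>n. ?controls (inverse (real (Suc n))) (\<delta> n)" by metis
  show "has_seq_henstock_integral f A a b"
    unfolding has_seq_henstock_integral_def
  proof (intro exI[of _ \<delta>] conjI allI impI)
    show "pos_gauge a b (\<delta> n)" for n using \<delta> by blast
  next
    fix P assume "\<forall>n. is_tagged_partition a b (P n) \<and> gauge_fine (\<delta> n) (P n)"
    then have "\<bar>riemann_sum f (P n) - A\<bar> < inverse (real (Suc n))" for n
      using \<delta> by blast
    then have "(\<lambda>n. riemann_sum f (P n) - A) \<longlonglongrightarrow> 0"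
      by (intro Lim_null_comparison[OF _ LIMSEQ_inverse_real_of_nat])
        (auto intro!: always_eventually less_imp_le)
    then show "(\<lambda>n. riemann_sum f (P n)) \<longlonglongrightarrow> A" by (simp add: LIM_zero_iff)
  qed
qed

text \<open>
  The pointwise minimum of two gauges makes the Riemann sums of \<open>f\<close> and \<open>g\<close> converge along the same
  partitions; the bound on their difference survives in the limit.
\<close>

lemma seq_henstock_integral_diff_le:
  assumes "a \<le> b"
    and f: "has_seq_henstock_integral f A a b" and g: "has_seq_henstock_integral g B a b"
    and close: "\<And>x. x \<in> {a..b} \<Longrightarrow> \<bar>f x - g x\<bar> \<le> e"
  shows "\<bar>A - B\<bar> \<le> e * (b - a)"
proof -
  from f obtain \<delta> where \<delta>: "\<And>n. pos_gauge a b (\<delta> n)"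
    and limf: "\<And>P. (\<And>n. is_tagged_partition a b (P n) \<and> gauge_fine (\<delta> n) (P n)) \<Longrightarrow>
                 (\<lambda>n. riemann_sum f (P n)) \<longlonglongrightarrow> A"
    unfolding has_seq_henstock_integral_def by blast
  from g obtain \<eta> where \<eta>: "\<And>n. pos_gauge a b (\<eta> n)"
    and limg: "\<And>P. (\<And>n. is_tagged_partition a b (P n) \<and> gauge_fine (\<eta> n) (P n)) \<Longrightarrow>
                 (\<lambda>n. riemann_sum g (P n)) \<longlonglongrightarrow> B"
    unfolding has_seq_henstock_integral_def by blast
  have "pos_gauge a b (\<lambda>x. min (\<delta> n x) (\<eta> n x))" for n
    using \<delta>[of n] \<eta>[of n] by (simp add: pos_gauge_def)
  then have "\<forall>n. \<exists>P. is_tagged_partition a b P \<and> gauge_fine (\<lambda>x. min (\<delta> n x) (\<eta> n x)) P"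
    using fine_partition_exists[OF \<open>a \<le> b\<close>] by blast
  from choice[OF this] obtain P where P: "\<And>n. is_tagged_partition a b (P n)"
    and fine: "\<And>n. gauge_fine (\<lambda>x. min (\<delta> n x) (\<eta> n x)) (P n)"
    by blast
  have "gauge_fine (\<delta> n) (P n)" "gauge_fine (\<eta> n) (P n)" for n
    using fine[of n] by (auto simp: gauge_fine_def)
  with P limf limg have "(\<lambda>n. \<bar>riemann_sum f (P n) - riemann_sum g (P n)\<bar>) \<longlonglongrightarrow> \<bar>A - B\<bar>"
    by (intro tendsto_rabs tendsto_diff) blast+
  then show ?thesis
    using riemann_sum_diff_le[OF P close] by (intro LIMSEQ_le_const2) auto
qed

lemma seq_henstock_integral_eqI:
  assumes "a \<le> b" and "has_seq_henstock_integral f A a b"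
  shows "seq_henstock_integral f a b = A"
  unfolding seq_henstock_integral_def
proof (rule the_equality)
  fix B assume "has_seq_henstock_integral f B a b"
  from seq_henstock_integral_diff_le[OF assms(1) this assms(2), of 0] show "B = A" by simp
qed fact

section \<open>Uniform limits\<close>

lemma has_seq_henstock_integral_uniform_limit:
  assumes F: "\<And>k. has_seq_henstock_integral (F k) (J k) a b"
    and unif: "uniform_limit {a..b} F f sequentially"
    and J: "J \<longlonglongrightarrow> A"
    and "a \<le> b"
  shows "has_seq_henstock_integral f A a b"
  unfolding has_seq_henstock_integral_iff
proof (intro allI impI)
  fix e :: real assume "e > 0"
  \<comment> \<open>Chosen so that the three errors \<open>e' (b - a)\<close>, \<open>e'\<close> and \<open>e'\<close> add up to \<open>e\<close>.\<close>
  define e' where "e' = e / (b - a + 2)"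
  have "e' > 0" and "e' * (b - a + 2) = e"
    using \<open>e > 0\<close> \<open>a \<le> b\<close> by (simp_all add: e'_def)
  then have e: "e' * (b - a) + e' + e' = e" by (simp add: algebra_simps)
  have "\<forall>\<^sub>F k in sequentially. (\<forall>x\<in>{a..b}. dist (F k x) (f x) < e') \<and> dist (J k) A < e'"
    using uniform_limitD[OF unif \<open>e' > 0\<close>] tendstoD[OF J \<open>e' > 0\<close>] by (rule eventually_conj)
  then obtain k where k: "\<forall>x\<in>{a..b}. dist (F k x) (f x) < e'" "dist (J k) A < e'"
    using eventually_happens'[OF sequentially_bot] by blast
  have Fk: "\<bar>f x - F k x\<bar> \<le> e'" if "x \<in> {a..b}" for x
    using k(1) that by (simp add: dist_real_def abs_minus_commute less_imp_le)
  have Jk: "\<bar>J k - A\<bar> < e'" using k(2) by (simp add: dist_real_def)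
  from F[of k] \<open>e' > 0\<close> obtain \<delta> where "pos_gauge a b \<delta>"
    and \<delta>: "\<And>P. is_tagged_partition a b P \<Longrightarrow> gauge_fine \<delta> P \<Longrightarrow> \<bar>riemann_sum (F k) P - J k\<bar> < e'"
    unfolding has_seq_henstock_integral_iff by blast
  moreover have "\<bar>riemann_sum f P - A\<bar> < e" if "is_tagged_partition a b P" "gauge_fine \<delta> P" for P
    using riemann_sum_diff_le[of a b P f "F k" e', OF that(1) Fk] \<delta>[OF that] Jk e by linarith
  ultimately show "\<exists>\<delta>. pos_gauge a b \<delta> \<and>
      (\<forall>P. is_tagged_partition a b P \<and> gauge_fine \<delta> P \<longrightarrow> \<bar>riemann_sum f P - A\<bar> < e)"
    by blast
qed

theorem theorem13:
  fixes a b :: real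
    and fk :: "nat \<Rightarrow> real \<Rightarrow> real"
    and f :: "real \<Rightarrow> real"
  assumes "a \<le> b"
    and "\<And>k. seq_henstock_integrable (fk k) a b"
    and "uniform_limit {a..b} fk f sequentially"
  shows "seq_henstock_integrable f a b \<and>
    (\<lambda>k. seq_henstock_integral (fk k) a b) \<longlonglongrightarrow> seq_henstock_integral f a b"
proof -
  let ?J = "\<lambda>k. seq_henstock_integral (fk k) a b"
  have J: "has_seq_henstock_integral (fk k) (?J k) a b" for k
    using assms(2)[of k] seq_henstock_integral_eqI[OF assms(1)]
    unfolding seq_henstock_integrable_def by metis
  have "Cauchy ?J"
  proof (rule CauchyI)
    fix e :: real assume "e > 0"
    \<comment> \<open>The summand 1 keeps the denominator positive when \<open>a = b\<close>.\<close>
    define e' where "e' = e / (b - a + 1)"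
    have "e' > 0" and e: "e' * (b - a) < e"
      using \<open>e > 0\<close> assms(1) by (auto simp: e'_def field_simps)
    have "uniformly_Cauchy_on {a..b} fk"
      using assms(3) by (intro uniformly_convergent_Cauchy) (auto simp: uniformly_convergent_on_def)
    then obtain M where M: "\<And>x m n. x \<in> {a..b} \<Longrightarrow> m \<ge> M \<Longrightarrow> n \<ge> M \<Longrightarrow> dist (fk m x) (fk n x) < e'"
      using \<open>e' > 0\<close> unfolding uniformly_Cauchy_on_def by blast
    have "\<bar>?J m - ?J n\<bar> < e" if "m \<ge> M" "n \<ge> M" for m n
    proof -
      have "\<bar>?J m - ?J n\<bar> \<le> e' * (b - a)"
        using M that by (intro seq_henstock_integral_diff_le[OF assms(1) J J])
          (auto simp: dist_real_def less_imp_le)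
      with e show ?thesis by simp
    qed
    then show "\<exists>M. \<forall>m\<ge>M. \<forall>n\<ge>M. norm (?J m - ?J n) < e" by auto
  qed
  then obtain A where A: "?J \<longlonglongrightarrow> A"
    using Cauchy_convergent convergentD by blast
  have "has_seq_henstock_integral f A a b"
    by (rule has_seq_henstock_integral_uniform_limit[OF J assms(3) A assms(1)])
  with A seq_henstock_integral_eqI[OF assms(1) this] show ?thesis
    unfolding seq_henstock_integrable_def by auto
qed

end
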